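(* Let $(\lambda,v)$ be a simple eigenpair of the problem $A(v)v=\lambda v$, with $\lambda\neq 0$ and $\frac12 v^Tv=1$, and let $u\in\mathbb{R}^n\setminus\{0\}$ be a left eigenvector of $J(v)$ corresponding to $\lambda$, i.e. $u^TJ(v)=\lambda u^T$. Let $w_1,\dots,w_m\ge 0$ be given weights. Then the normwise eigenvalue condition number $\kappa(\lambda)$ is given by $$\kappa(\lambda)=\frac{\left(\sum_{i=1}^m|f_i(v)|\,w_i\right)\|u\|\,\|v\|}{|\lambda|\,|u^Tv|}.$$ This holds whether the perturbation matrices in the definition of $\kappa(\lambda)$ are measured in the spectral norm or in the Frobenius norm.
   Context: Setting. Let $n,m$ be positive integers, and let $A:\mathbb{R}^n\to\mathbb{R}^{n\times n}$ be of the form $A(v)=\sum_{i=1}^m f_i(v)A_i$, where each $A_i\in\mathbb{R}^{n\times n}$ is symmetric and each $f_i:\mathbb{R}^n\to\mathbb{R}$ is scaling invariant, i.e. $f_i(\alpha x)=f_i(x)$ for all $x\in\mathbb{R}^n$ and $\alpha\in\mathbb{R}\setminus\{0\}$, and continuously differentiable on $\mathbb{R}^n\setminus\{0\}$. Hence $A(v)$ is symmetric, $A(\alpha x)=A(x)$ for $\alpha\ne0$, and $A$ is continuously differentiable on $\mathbb{R}^n\setminus\{0\}$. An eigenpair is $(\lambda,v)\in\mathbb{R}\times(\mathbb{R}^n\setminus\{0\})$ with $A(v)v=\lambda v$. The Jacobian is $J(v):=\frac{\partial}{\partial v}\left(A(v)v\right)\in\mathbb{R}^{n\times n}$. (By scaling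 invariance $J(v)v=A(v)v$, so $v$ is an eigenvector of $J(v)$ with eigenvalue $\lambda$.) The eigenpair $(\lambda,v)$ is called simple if $\lambda$ is a simple (algebraic multiplicity one) eigenvalue of the matrix $J(v)$ with eigenvector $v$. Perturbations. Fix matrices $E_1,\dots,E_m\in\mathbb{R}^{n\times n}$. For a simple eigenpair $(\lambda,v)$ with $\frac12v^Tv=1$, the implicit function theorem gives an open set $\mathcal U\subset\mathbb{R}$ containing $0$ and unique differentiable functions $\lambda(\varepsilon),v(\varepsilon)$ on $\mathcal U$ with $\lambda(0)=\lambda$, $v(0)=v$ and, for all $\varepsilon\in\mathcal U$, $$\Big(A(v(\varepsilon))+\varepsilon\sum_{i=1}^m f_i(v(\varepsilon))E_i\Big)v(\varepsilon)=\lambda(\varepsilon)v(\varepsilon),\qquad \tfrac12 v(\varepsilon)^Tv(\varepsilon)=1 .$$ Write $\lambda'=\lambda'(0)$ (it depends on $E_1,\dots,E_m$). Definition. Given weights $w_i\ge0$, $$\kappa(\lambda)=\sup\left\{\frac{|\lambda'|}{|\lambda|}:\ E_i\in\mathbb{R}^{n\times n},\ \|E_i\|\le w_i,\ i=1,\dots,m\right\},$$ where the matrix norm is either the spectral norm or the Frobenius norm. For vectors, $\|\cdot\|$ is the Euclidean norm. *)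

theory Defs
  imports "HOL-Analysis.Analysis" "HOL-Computational_Algebra.Polynomial"
begin

definition scaling_invariant :: "(real^'n \<Rightarrow> real) \<Rightarrow> bool" where
  "scaling_invariant g \<longleftrightarrow> (\<forall>x \<alpha>. \<alpha> \<noteq> 0 \<longrightarrow> g (\<alpha> *\<^sub>R x) = g x)"

(* Intended for open S only: the derivative is the unrestricted one, taken at x. *)
definition cont_differentiable_on :: "(real^'n \<Rightarrow> real) \<Rightarrow> (real^'n) set \<Rightarrow> bool" where
  "cont_differentiable_on g S \<longleftrightarrow>
     (\<exists>g' :: real^'n \<Rightarrow> (real^'n) \<Rightarrow>\<^sub>L real.
        (\<forall>x\<in>S. (g has_derivative blinfun_apply (g' x)) (at x)) \<and> continuous_on S g')"

definition Afun :: "('m::finite \<Rightarrow> real^'n \<Rightarrow> real) \<Rightarrow> ('m \<Rightarrow> real^'n^'n) \<Rightarrow> real^'n \<Rightarrow> real^'n^'n" where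
  "Afun f A v = (\<Sum>i\<in>UNIV. f i v *\<^sub>R A i)"

definition Jac :: "('m::finite \<Rightarrow> real^'n \<Rightarrow> real) \<Rightarrow> ('m \<Rightarrow> real^'n^'n) \<Rightarrow> real^'n \<Rightarrow> real^'n^'n" where
  "Jac f A v = jacobian (\<lambda>x. Afun f A x *v x) (at v)"

definition eigenpair ::
  "('m::finite \<Rightarrow> real^'n \<Rightarrow> real) \<Rightarrow> ('m \<Rightarrow> real^'n^'n) \<Rightarrow> real \<Rightarrow> real^'n \<Rightarrow> bool" where
  "eigenpair f A lam v \<longleftrightarrow> v \<noteq> 0 \<and> Afun f A v *v v = lam *\<^sub>R v"

(* det (X I - M), computed over the polynomial ring; [:0, 1:] is the variable X. *)
definition charpoly :: "real^'n^'n \<Rightarrow> real poly" where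
  "charpoly M = det (mat [:0, 1:] - (\<chi> i j. [:M $ i $ j:]) :: real poly^'n^'n)"

definition simple_eigenvalue_with :: "real^'n^'n \<Rightarrow> real \<Rightarrow> real^'n \<Rightarrow> bool" where
  "simple_eigenvalue_with M lam x \<longleftrightarrow>
     x \<noteq> 0 \<and> M *v x = lam *\<^sub>R x \<and> order lam (charpoly M) = 1"

definition simple_eigenpair ::
  "('m::finite \<Rightarrow> real^'n \<Rightarrow> real) \<Rightarrow> ('m \<Rightarrow> real^'n^'n) \<Rightarrow> real \<Rightarrow> real^'n \<Rightarrow> bool" where
  "simple_eigenpair f A lam v \<longleftrightarrow>
     eigenpair f A lam v \<and> simple_eigenvalue_with (Jac f A v) lam v"

definition perturbed_branch ::
  "('m::finite \<Rightarrow> real^'n \<Rightarrow> real) \<Rightarrow> ('m \<Rightarrow> real^'n^'n) \<Rightarrow> ('m \<Rightarrow> real^'n^'n) \<Rightarrow>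
    real \<Rightarrow> real^'n \<Rightarrow> real set \<Rightarrow> (real \<Rightarrow> real) \<Rightarrow> (real \<Rightarrow> real^'n) \<Rightarrow> bool" where
  "perturbed_branch f A E lam v U L V \<longleftrightarrow>
     open U \<and> 0 \<in> U \<and> L differentiable_on U \<and> V differentiable_on U \<and> L 0 = lam \<and> V 0 = v \<and>
     (\<forall>\<epsilon>\<in>U. (Afun f A (V \<epsilon>) + \<epsilon> *\<^sub>R (\<Sum>i\<in>UNIV. f i (V \<epsilon>) *\<^sub>R E i)) *v V \<epsilon> = L \<epsilon> *\<^sub>R V \<epsilon> \<and>
              (1/2) * (V \<epsilon> \<bullet> V \<epsilon>) = 1)"

(* The number lambda'(0). It is meaningful for a simple eigenpair with (1/2) v^T v = 1: a branch
   exists by the implicit function theorem, and all branches have the same derivative at 0. *)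
definition eigenvalue_deriv ::
  "('m::finite \<Rightarrow> real^'n \<Rightarrow> real) \<Rightarrow> ('m \<Rightarrow> real^'n^'n) \<Rightarrow> ('m \<Rightarrow> real^'n^'n) \<Rightarrow>
    real \<Rightarrow> real^'n \<Rightarrow> real" where
  "eigenvalue_deriv f A E lam v =
     (THE d. \<exists>U L V. perturbed_branch f A E lam v U L V \<and> (L has_real_derivative d) (at 0))"

definition spectral_norm :: "real^'n^'n \<Rightarrow> real" where
  "spectral_norm M = onorm ((*v) M)"

(* The type-class norm on matrices is the Frobenius norm. *)
lemma norm_matrix_eq_frobenius:
  fixes M :: "real^'n^'n"
  shows "norm M = sqrt (\<Sum>i\<in>UNIV. \<Sum>j\<in>UNIV. (M $ i $ j)\<^sup>2)"
  by (simp add: norm_vec_def L2_set_def sum_nonneg)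

(* The supremum is taken in the extended
   reals, so an unbounded set would give infinity. *)
definition eig_cond ::
  "(real^'n^'n \<Rightarrow> real) \<Rightarrow> ('m::finite \<Rightarrow> real^'n \<Rightarrow> real) \<Rightarrow> ('m \<Rightarrow> real^'n^'n) \<Rightarrow>
    ('m \<Rightarrow> real) \<Rightarrow> real \<Rightarrow> real^'n \<Rightarrow> ereal" where
  "eig_cond N f A w lam v =
     (SUP E\<in>{E :: 'm \<Rightarrow> real^'n^'n. \<forall>i. N (E i) \<le> w i}.
        ereal (\<bar>eigenvalue_deriv f A E lam v\<bar> / \<bar>lam\<bar>))"

end

theory Submission
  imports Defs
begin

text \<open>
  Differentiating the perturbed equation along a branch and multiplying by \<open>u\<^sup>T\<close> removes the
  derivative of the eigenvector, because \<open>u\<^sup>T J(v) = lam u\<^sup>T\<close>. What is left is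
  \<open>lam'(0) = u\<^sup>T (\<Sum>i. f i v E i) v / (u\<^sup>T v)\<close>, and the supremum follows from Cauchy-Schwarz, with
  equality for rank-one perturbations \<open>E i\<close> proportional to \<open>u v\<^sup>T\<close>.

  Simplicity of \<open>lam\<close> enters twice, both times because a Jordan chain above \<open>v\<close> or a second
  eigenvector would make \<open>lam\<close> a double root of the characteristic polynomial: it
  gives \<open>u\<^sup>T v \<noteq> 0\<close>, and it makes the derivative of
  \<open>(\<epsilon>, x, l) \<mapsto> (\<epsilon>, A(x) x + \<epsilon> E(x) x - l x, x\<^sup>T x / 2)\<close> at \<open>(0, v, lam)\<close> injective, so that
  a branch exists by the inverse function theorem.
\<close>

section \<open>Characteristic polynomials and simple eigenvalues\<close>

lemma poly_det:
  fixes N :: "real poly^'n^'n"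
  shows "poly (det N) t = det (\<chi> i j. poly (N $ i $ j) t)"
  by (simp add: det_def poly_sum poly_prod)

lemma poly_charpoly:
  fixes M :: "real^'n^'n"
  shows "poly (charpoly M) t = det (mat t - M)"
proof -
  have "(\<chi> i j. poly ((mat [:0, 1:] - (\<chi> i j. [:M $ i $ j:]) :: real poly^'n^'n) $ i $ j) t) = mat t - M"
    by (simp add: vec_eq_iff mat_def)
  then show ?thesis
    by (simp add: charpoly_def poly_det)
qed

lemma mat_mult_vec: "mat c *v x = c *\<^sub>R (x :: real^'n)"
  by (simp add: vec_eq_iff matrix_vector_mult_def mat_def if_distrib if_distribR cong: if_cong)

text \<open>For \<open>t\<close> above the operator norm of \<open>M\<close> no eigenvector to
  \<open>t\<close> can exist, so \<open>mat t - M\<close> is invertible and the polynomial does not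
  vanish at \<open>t\<close>. This rules out the zero polynomial, which every power of a linear
  factor divides, when divisibility is turned into a bound on \<open>order\<close>.\<close>

lemma charpoly_nonzero:
  fixes M :: "real^'n^'n"
  shows "charpoly M \<noteq> 0"
proof -
  define t where "t = onorm ((*v) M) + 1"
  have "x = 0" if "(mat t - M) *v x = 0" for x
  proof (rule ccontr)
    assume "x \<noteq> 0"
    have "M *v x = t *\<^sub>R x"
      using that by (simp add: matrix_vector_mult_diff_rdistrib mat_mult_vec)
    then have "\<bar>t\<bar> * norm x \<le> onorm ((*v) M) * norm x"
      using onorm[OF matrix_vector_mul_bounded_linear, of M x] by simp
    with \<open>x \<noteq> 0\<close> show False
      by (simp add: t_def)
  qed
  then have "invertible (mat t - M)"
    using matrix_left_invertible_ker invertible_left_inverse by blast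
  then have "poly (charpoly M) t \<noteq> 0"
    by (simp add: poly_charpoly invertible_det_nz)
  then show ?thesis by auto
qed

text \<open>A basis containing both vectors has as many elements as the index type, so a bijection
  turns it into the rows of a square matrix. Row operations on two named rows \<open>i\<close> and
  \<open>j\<close> then become available.\<close>

lemma extend_independent_pair:
  fixes v x :: "real^'n"
  assumes "independent {v, x}" "v \<noteq> x"
  obtains p :: "'n \<Rightarrow> real^'n" and i j
  where "i \<noteq> j" "p i = v" "p j = x" "det (\<chi> k. p k) \<noteq> 0"
proof -
  obtain B where B: "{v, x} \<subseteq> B" "independent B" "UNIV \<subseteq> span B"
    by (rule maximal_independent_subset_extend[OF subset_UNIV assms(1)])
  then have "card B = CARD('n)"
    using basis_card_eq_dim[of B UNIV] by simp
  then obtain p :: "'n \<Rightarrow> real^'n" where p: "bij_betw p UNIV B"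
    using B(2) by (metis finite_class.finite_UNIV finite_same_card_bij independent_imp_finite)
  obtain i j where ij: "p i = v" "p j = x"
    using p B(1) by (metis bij_betw_imp_surj_on imageE insert_subset)
  have "rows (\<chi> k. p k) = B"
    using p by (auto simp: rows_def row_def bij_betw_def)
  then have "invertible (\<chi> k. p k)"
    using B(3) by (metis invertible_left_inverse matrix_left_invertible_span_rows span_vec_eq top.extremum_uniqueI)
  with ij assms(2) show ?thesis
    using that by (metis invertible_det_nz)
qed

text \<open>If \<open>x\<close> is independent of \<open>v\<close>, then \<open>v\<close> and \<open>x\<close> span an invariant plane on which \<open>M\<close> has
  characteristic polynomial \<open>(X - lam)\<^sup>2\<close>.\<close>

lemma simple_eigenvalue_chain:
  fixes M :: "real^'n^'n"
  assumes simple: "simple_eigenvalue_with M lam v"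
    and x: "M *v x - lam *\<^sub>R x = \<mu> *\<^sub>R v"
  obtains c where "x = c *\<^sub>R v"
proof (rule ccontr)
  have v: "v \<noteq> 0" "M *v v = lam *\<^sub>R v" and ord: "order lam (charpoly M) = 1"
    using simple by (auto simp: simple_eigenvalue_with_def)
  assume "\<not> thesis"
  then have "x \<notin> span {v}"
    using that by (auto simp: span_singleton)
  then have "independent {x, v}" "v \<noteq> x"
    using v(1) by (auto simp: independent_insert span_base)
  then have "independent {v, x}" "v \<noteq> x"
    by (simp_all add: insert_commute)
  then obtain p :: "'n \<Rightarrow> real^'n" and i j
    where p: "i \<noteq> j" "p i = v" "p j = x" "det (\<chi> k. p k) \<noteq> 0"
    by (rule extend_independent_pair)
  \<comment> \<open>\<open>S t\<close> is what remains of the rows \<open>(mat t - M) *v p k\<close>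
    after a factor \<open>t - lam\<close> has been taken out of each of the rows \<open>i\<close>
    and \<open>j\<close>.\<close>
  define S :: "real \<Rightarrow> real^'n^'n" where
    "S t = (\<chi> k. if k = i then v else if k = j then x else (mat t - M) *v p k)" for t
  \<comment> \<open>The same matrix with polynomial entries: the linear polynomial in the last case
    is the \<open>l\<close>-th entry of \<open>t *\<^sub>R p k - M *v p k\<close>. It makes the
    cofactor of the double root a polynomial, as divisibility requires.\<close>
  define SS :: "real poly^'n^'n" where
    "SS = (\<chi> k l. if k = i then [:v $ l:] else if k = j then [:x $ l:]
       else [:- ((M *v p k) $ l), p k $ l:])"
  have S_eq: "poly (det SS) t = det (S t)" for t
    unfolding poly_det
    by (rule arg_cong[where f = det])
       (simp add: SS_def S_def vec_eq_iff matrix_vector_mult_diff_rdistrib mat_mult_vec)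
  have det_eq: "det (mat t - M) * det (\<chi> k. p k) = (t - lam)\<^sup>2 * det (S t)" for t
  proof -
    let ?K = "mat t - M"
    have Kv: "?K *v v = (t - lam) *s v"
      using v(2) by (simp add: matrix_vector_mult_diff_rdistrib mat_mult_vec
          scalar_mult_eq_scaleR scaleR_diff_left)
    have Kx: "?K *v x + \<mu> *s v = (t - lam) *s x"
      using x by (simp add: matrix_vector_mult_diff_rdistrib mat_mult_vec
          scalar_mult_eq_scaleR algebra_simps)
    have "transpose (?K ** transpose (\<chi> k. p k)) = (\<chi> k. ?K *v p k)"
      by (simp add: vec_eq_iff transpose_def matrix_matrix_mult_def matrix_vector_mult_def)
    then have "det ?K * det (\<chi> k. p k) = det (\<chi> k. ?K *v p k)"
      by (metis det_mul det_transpose)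
    also have "(\<chi> k. ?K *v p k) = (\<chi> k. if k = i then (t - lam) *s v else ?K *v p k)"
      by (rule Cart_lambda_cong) (use Kv p in auto)
    also have "det \<dots> = (t - lam) * det (\<chi> k. if k = i then v else ?K *v p k)"
      by (rule det_row_mul)
    also have "det (\<chi> k. if k = i then v else ?K *v p k)
      = det (\<chi> k. if k = j then (t - lam) *s x else if k = i then v else ?K *v p k)"
    proof -
      let ?Z = "\<chi> k. if k = i then v else ?K *v p k"
      \<comment> \<open>Row \<open>j\<close> is \<open>(t - lam) *s x - \<mu> *s v\<close> and row
        \<open>i\<close> is now \<open>v\<close>, so adding \<mu> times row \<open>i\<close> clears
        the \<open>v\<close> term and exposes the second factor \<open>t - lam\<close>.\<close>
      have "det ?Z = det (\<chi> k. if k = j then row j ?Z + \<mu> *s row i ?Z else row k ?Z)"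
        using p by (intro det_row_operation[symmetric]) auto
      also have "(\<chi> k. if k = j then row j ?Z + \<mu> *s row i ?Z else row k ?Z)
        = (\<chi> k. if k = j then (t - lam) *s x else if k = i then v else ?K *v p k)"
        by (rule Cart_lambda_cong) (use p Kx in \<open>auto simp: row_def\<close>)
      finally show ?thesis .
    qed
    also have "\<dots> = (t - lam) * det (\<chi> k. if k = j then x else if k = i then v else ?K *v p k)"
      by (rule det_row_mul)
    also have "(\<chi> k. if k = j then x else if k = i then v else ?K *v p k) = S t"
      unfolding S_def by (rule Cart_lambda_cong) (use p in auto)
    finally show ?thesis by (simp add: power2_eq_square)
  qed
  \<comment> \<open>Real polynomials that agree at every point are equal, so the identity of values
    lifts to one of polynomials.\<close>
  have "smult (det (\<chi> k. p k)) (charpoly M) = [:- lam, 1:]\<^sup>2 * det SS"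
    by (rule poly_eq_poly_eq_iff[THEN iffD1])
       (use det_eq in \<open>simp add: fun_eq_iff poly_charpoly S_eq ac_simps\<close>)
  then have "[:- lam, 1:]\<^sup>2 dvd charpoly M"
    using p(4) by (metis dvd_smult_cancel dvd_triv_left)
  then show False
    using ord charpoly_nonzero[of M] order_divides[of lam 2 "charpoly M"] by simp
qed

text \<open>The range of \<open>M - lam\<close> is orthogonal to \<open>u\<close>. If
  \<open>v\<close> were orthogonal to \<open>u\<close> as well, it would lie in that range, and a
  preimage of \<open>v\<close> would continue a Jordan chain, which simplicity forbids.\<close>

lemma left_right_eigenvectors_not_orthogonal:
  fixes M :: "real^'n^'n"
  assumes simple: "simple_eigenvalue_with M lam v"
    and left: "u v* M = lam *\<^sub>R u" and "u \<noteq> 0"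
  shows "u \<bullet> v \<noteq> 0"
proof
  assume uv: "u \<bullet> v = 0"
  have v: "v \<noteq> 0" "M *v v = lam *\<^sub>R v"
    using simple by (auto simp: simple_eigenvalue_with_def)
  have u: "u \<bullet> (M *v x - lam *\<^sub>R x) = 0" for x
    using left by (simp add: inner_diff_right flip: dot_lmul_matrix)
  \<comment> \<open>The rank-one term makes \<open>M - lam\<close> bijective: pairing
    \<open>B x\<close> with \<open>u\<close> isolates \<open>v \<bullet> x\<close>, and a kernel
    vector is then both a multiple of \<open>v\<close> and orthogonal to \<open>v\<close>.
    Surjectivity of \<open>B\<close> supplies the preimage of \<open>v\<close>.\<close>
  define B where "B x = M *v x - lam *\<^sub>R x + (v \<bullet> x) *\<^sub>R u" for x
  have B_orth: "v \<bullet> x = 0" if "u \<bullet> B x = 0" for x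
    using that u[of x] \<open>u \<noteq> 0\<close> by (simp add: B_def inner_add_right)
  have "linear B"
    unfolding B_def by (rule linearI) (simp_all add: algebra_simps)
  moreover have "x = 0" if "B x = 0" for x
  proof -
    have "v \<bullet> x = 0"
      using B_orth that by simp
    moreover from this have "M *v x - lam *\<^sub>R x = 0 *\<^sub>R v"
      using that by (simp add: B_def)
    ultimately show ?thesis
      using simple_eigenvalue_chain[OF simple, of x 0] v(1) by (metis inner_eq_zero_iff inner_scaleR_right mult_eq_0_iff)
  qed
  ultimately have "surj B"
    by (simp add: linear_injective_0 linear_injective_imp_surjective)
  then obtain x where x: "B x = v" by (metis surjD)
  then have "v \<bullet> x = 0"
    using B_orth uv by simp
  with x have Mx: "M *v x - lam *\<^sub>R x = 1 *\<^sub>R v"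
    by (simp add: B_def)
  obtain c where "x = c *\<^sub>R v"
    by (rule simple_eigenvalue_chain[OF simple Mx])
  with Mx v show False
    by (simp add: matrix_vector_mult_scaleR mult.commute)
qed

section \<open>Differentiability of the nonlinear matrix-vector product\<close>

lemma norm_matrix_vector_mult_le:
  fixes M :: "real^'n^'m"
  shows "norm (M *v x) \<le> norm M * norm x"
proof -
  have "norm (M *v x) = L2_set (\<lambda>i. (M *v x) $ i) UNIV"
    by (simp add: norm_vec_def L2_set_def)
  also have "\<dots> \<le> L2_set (\<lambda>i. norm (M $ i) * norm x) UNIV"
    unfolding L2_set_def
    by (intro real_sqrt_le_mono sum_mono power2_mono)
       (simp add: matrix_vector_mul_component Cauchy_Schwarz_ineq2 abs_mult)
  also have "\<dots> = norm M * norm x"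
    by (simp add: norm_vec_def L2_set_left_distrib)
  finally show ?thesis .
qed

lemma bounded_bilinear_matrix_vector_mult:
  "bounded_bilinear ((*v) :: real^'n^'m \<Rightarrow> real^'n \<Rightarrow> real^'m)"
proof
  show "\<exists>K. \<forall>(M :: real^'n^'m) x. norm (M *v x) \<le> norm M * norm x * K"
    by (rule exI[of _ 1]) (simp add: norm_matrix_vector_mult_le)
qed (simp_all add: matrix_vector_mult_add_rdistrib matrix_vector_right_distrib
      scaleR_matrix_vector_assoc matrix_vector_mult_scaleR)

lemmas has_derivative_matrix_vector_mult =
  bounded_bilinear.FDERIV[OF bounded_bilinear_matrix_vector_mult]
lemmas continuous_on_matrix_vector_mult =
  bounded_bilinear.continuous_on[OF bounded_bilinear_matrix_vector_mult]

text \<open>The product rule. The coefficient matrices are arbitrary because the perturbation term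
  is also of the form \<open>Afun f E\<close>; the derivative is a bounded linear function so that
  it fits the inverse function theorem.\<close>

lemma Afun_mult_C1:
  fixes f :: "'m::finite \<Rightarrow> real^'n \<Rightarrow> real" and E :: "'m \<Rightarrow> real^'n^'n"
  assumes C1: "\<And>i. cont_differentiable_on (f i) S"
  obtains D :: "real^'n \<Rightarrow> (real^'n) \<Rightarrow>\<^sub>L (real^'n)"
  where "\<And>x. x \<in> S \<Longrightarrow> ((\<lambda>x. Afun f E x *v x) has_derivative blinfun_apply (D x)) (at x)"
    and "continuous_on S D"
proof -
  obtain f' :: "'m \<Rightarrow> real^'n \<Rightarrow> (real^'n) \<Rightarrow>\<^sub>L real"
    where f': "\<And>i x. x \<in> S \<Longrightarrow> (f i has_derivative blinfun_apply (f' i x)) (at x)"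
      and cont: "\<And>i. continuous_on S (f' i)"
    using C1 unfolding cont_differentiable_on_def by metis
  define D where "D x h = Afun f E x *v h + (\<Sum>i\<in>UNIV. f' i x h *\<^sub>R E i) *v x" for x h
  have deriv: "((\<lambda>x. Afun f E x *v x) has_derivative D x) (at x)" if "x \<in> S" for x
    unfolding D_def Afun_def
    by (rule has_derivative_matrix_vector_mult)
       (auto intro!: derivative_eq_intros f' that)
  have apply_D: "blinfun_apply (Blinfun (D x)) = D x" if "x \<in> S" for x
    using deriv[OF that] by (simp add: bounded_linear_Blinfun_apply has_derivative_bounded_linear)
  have "continuous_on S (\<lambda>x. Blinfun (D x))"
  \<comment> \<open>In finite dimension, continuity of an operator-valued map may be checked on each
    basis vector.\<close>
  proof (rule continuous_on_blinfun_componentwise)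
    fix b :: "real^'n"
    have "continuous_on S (f i)" for i
      using f' by (metis has_derivative_continuous continuous_at_imp_continuous_on)
    then have "continuous_on S (\<lambda>x. D x b)"
      unfolding D_def Afun_def
      by (intro continuous_intros continuous_on_matrix_vector_mult cont)
    then show "continuous_on S (\<lambda>x. blinfun_apply (Blinfun (D x)) b)"
      by (rule continuous_on_eq) (simp add: apply_D)
  qed
  then show ?thesis
    using that[of "\<lambda>x. Blinfun (D x)"] deriv apply_D by simp
qed

lemma Jac_mult:
  assumes "((\<lambda>x. Afun f A x *v x) has_derivative D) (at v)"
  shows "Jac f A v *v h = D h"
  using has_derivative_linear[OF assms]
  by (simp add: Jac_def jacobian_def matrix_works flip: frechet_derivative_at[OF assms])

section \<open>Perturbed branches and the derivative of the eigenvalue\<close>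

text \<open>The implicit function is extracted from the inverse function theorem: \<open>G\<close>
  keeps \<epsilon> as its first component, and its other two are the residual of the eigenvalue
  equation and the normalization. The branch is the local inverse along the points (\<epsilon>, 0,
  1).\<close>

lemma perturbed_branch_exists:
  fixes f :: "'m::finite \<Rightarrow> real^'n \<Rightarrow> real" and A E :: "'m \<Rightarrow> real^'n^'n"
  assumes C1: "\<And>i. cont_differentiable_on (f i) (UNIV - {0})"
    and simple: "simple_eigenpair f A lam v"
    and left: "u v* Jac f A v = lam *\<^sub>R u" "u \<noteq> 0"
    and nrm: "(1/2) * (v \<bullet> v) = 1"
  obtains U L V where "perturbed_branch f A E lam v U L V"
proof -
  let ?S = "UNIV - {0 :: real^'n}"
  have v: "v \<noteq> 0" "Afun f A v *v v = lam *\<^sub>R v"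
    and simpJ: "simple_eigenvalue_with (Jac f A v) lam v"
    using simple by (auto simp: simple_eigenpair_def eigenpair_def)
  have uv: "u \<bullet> v \<noteq> 0"
    using left_right_eigenvectors_not_orthogonal[OF simpJ left] .
  obtain DA where DA: "\<And>x. x \<in> ?S \<Longrightarrow> ((\<lambda>x. Afun f A x *v x) has_derivative blinfun_apply (DA x)) (at x)"
    and DA_cont: "continuous_on ?S DA"
    using Afun_mult_C1[where f = f and E = A, OF C1] by blast
  obtain DE where DE: "\<And>x. x \<in> ?S \<Longrightarrow> ((\<lambda>x. Afun f E x *v x) has_derivative blinfun_apply (DE x)) (at x)"
    and DE_cont: "continuous_on ?S DE"
    using Afun_mult_C1[where f = f and E = E, OF C1] by blast
  define T :: "(real \<times> (real^'n) \<times> real) set" where "T = UNIV \<times> ?S \<times> UNIV"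
  define G :: "real \<times> (real^'n) \<times> real \<Rightarrow> real \<times> (real^'n) \<times> real" where
    "G p = (fst p, Afun f A (fst (snd p)) *v fst (snd p)
        + fst p *\<^sub>R (Afun f E (fst (snd p)) *v fst (snd p)) - snd (snd p) *\<^sub>R fst (snd p),
      (1/2) * (fst (snd p) \<bullet> fst (snd p)))" for p
  define G' :: "real \<times> (real^'n) \<times> real \<Rightarrow> real \<times> (real^'n) \<times> real \<Rightarrow> real \<times> (real^'n) \<times> real" where
    "G' p d = (fst d, DA (fst (snd p)) (fst (snd d))
        + (fst p *\<^sub>R DE (fst (snd p)) (fst (snd d)) + fst d *\<^sub>R (Afun f E (fst (snd p)) *v fst (snd p)))
        - (snd (snd p) *\<^sub>R fst (snd d) + snd (snd d) *\<^sub>R fst (snd p)),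
      fst (snd p) \<bullet> fst (snd d))" for p d
  let ?p = "(0, v, lam)"
  have "open T"
    unfolding T_def by (intro open_Times) auto
  have p_T: "?p \<in> T"
    using v by (simp add: T_def)
  have fst_snd: "((\<lambda>p. fst (snd p)) has_derivative (\<lambda>d. fst (snd d))) (at p)"
    for p :: "real \<times> (real^'n) \<times> real"
    by (auto intro!: derivative_eq_intros)
  have G_deriv: "(G has_derivative G' p) (at p)" if "p \<in> T" for p
  proof -
    have "fst (snd p) \<in> ?S" using that by (auto simp: T_def)
    note A = has_derivative_compose[OF fst_snd DA[OF this]]
      and E = has_derivative_compose[OF fst_snd DE[OF this]]
    show ?thesis
      unfolding G_def[abs_def] G'_def[abs_def]
      by (rule derivative_eq_intros A E refl fst_snd | simp add: inner_commute)+
  qed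
  have G'_apply: "blinfun_apply (Blinfun (G' p)) = G' p" if "p \<in> T" for p
    using G_deriv[OF that] by (simp add: bounded_linear_Blinfun_apply has_derivative_bounded_linear)
  have G_blinfun: "(G has_derivative blinfun_apply (Blinfun (G' p))) (at p)" if "p \<in> T" for p
    using G_deriv[OF that] by (simp add: G'_apply[OF that])
  have G'_cont: "continuous_on T (\<lambda>p. Blinfun (G' p))"
  proof (rule continuous_on_blinfun_componentwise)
    fix b :: "real \<times> (real^'n) \<times> real"
    have comp: "continuous_on T (\<lambda>p. g (fst (snd p)))" if "continuous_on ?S g"
      for g :: "real^'n \<Rightarrow> 'x::topological_space"
      by (rule continuous_on_compose2[OF that]) (auto intro!: continuous_intros simp: T_def)
    have "continuous_on ?S (\<lambda>x. Afun f E x *v x)"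
      using DE by (auto intro!: continuous_at_imp_continuous_on has_derivative_continuous)
    then have "continuous_on T (\<lambda>p. G' p b)"
      unfolding G'_def
      by (intro continuous_intros comp[OF DA_cont] comp[OF DE_cont]
            comp[of "\<lambda>x. Afun f E x *v x"])
    then show "continuous_on T (\<lambda>p. blinfun_apply (Blinfun (G' p)) b)"
      by (rule continuous_on_eq) (simp add: G'_apply)
  qed
  have lin: "linear (G' ?p)"
    using G_deriv[OF p_T] by (rule has_derivative_linear)
  \<comment> \<open>The first component gives \<open>h = 0\<close>, the second puts \<open>k\<close>
    in a chain above \<open>v\<close>, hence \<open>k\<close> is a multiple of \<open>v\<close>, and
    the third makes it orthogonal to \<open>v\<close>. With \<open>k = 0\<close> the chain equation
    leaves \<open>m *\<^sub>R v = 0\<close>.\<close>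
  have "d = 0" if "G' ?p d = 0" for d
  proof -
    obtain h k m where d: "d = (h, k, m)" by (metis prod.exhaust)
    have h: "h = 0" and vk: "v \<bullet> k = 0"
      and k: "Jac f A v *v k - lam *\<^sub>R k = m *\<^sub>R v"
      using that by (auto simp: G'_def d zero_prod_def Jac_mult[OF DA] v(1) algebra_simps)
    obtain c where "k = c *\<^sub>R v"
      by (rule simple_eigenvalue_chain[OF simpJ k])
    with vk v(1) have "k = 0" by auto
    with k v(1) h show ?thesis
      by (simp add: d zero_prod_def)
  qed
  then obtain B where B: "linear B" "B \<circ> G' ?p = id"
    using linear_injective_left_inverse[OF lin] lin by (metis linear_injective_0)
  have BG: "B (G' ?p d) = d" for d
    using B(2) by (metis comp_apply id_apply)
  have inv: "Blinfun B o\<^sub>L Blinfun (G' ?p) = id_blinfun"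
    by (rule blinfun_eqI)
       (use B(1) p_T BG in \<open>simp add: G'_apply bounded_linear_Blinfun_apply linear_conv_bounded_linear\<close>)
  obtain T' W g g' where "?p \<in> T'" "open W" "G ?p \<in> W" "homeomorphism T' W G g"
    and g': "\<And>y. y \<in> W \<Longrightarrow> (g has_derivative (g' y)) (at y)"
  proof (rule inverse_function_theorem[OF \<open>open T\<close> G_blinfun G'_cont p_T inv])
    fix T' W g g'
    assume "?p \<in> T'" "open W" "G ?p \<in> W" "homeomorphism T' W G g"
      and "\<And>y. y \<in> W \<Longrightarrow> (g has_derivative (g' y)) (at y)"
    then show thesis by (rule that)
  qed
  have G_p: "G ?p = (0, 0, 1)"
    using v(2) nrm by (simp add: G_def)
  define U where "U = (\<lambda>\<epsilon>. (\<epsilon>, 0 :: real^'n, 1 :: real)) -` W"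
  define V where "V \<epsilon> = fst (snd (g (\<epsilon>, 0, 1)))" for \<epsilon>
  define L where "L \<epsilon> = snd (snd (g (\<epsilon>, 0, 1)))" for \<epsilon>
  have "open U"
    unfolding U_def using \<open>open W\<close> by (rule open_vimage) (intro continuous_intros)
  have "0 \<in> U"
    using \<open>G ?p \<in> W\<close> by (simp add: U_def G_p)
  have g_p: "g (0, 0, 1) = ?p"
    using \<open>homeomorphism T' W G g\<close> \<open>?p \<in> T'\<close> by (metis G_p homeomorphism_apply1)
  have "V differentiable (at \<epsilon>)" "L differentiable (at \<epsilon>)" if "\<epsilon> \<in> U" for \<epsilon>
  proof -
    have "((\<lambda>\<epsilon>. (\<epsilon>, 0 :: real^'n, 1 :: real)) has_derivative (\<lambda>h. (h, 0, 0))) (at \<epsilon>)"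
      by (auto intro!: derivative_eq_intros simp: zero_prod_def)
    from has_derivative_compose[OF this g'] that
    have D: "((\<lambda>\<epsilon>. g (\<epsilon>, 0, 1)) has_derivative (\<lambda>h. g' (\<epsilon>, 0, 1) (h, 0, 0))) (at \<epsilon>)"
      by (simp add: U_def)
    show "V differentiable (at \<epsilon>)" "L differentiable (at \<epsilon>)"
      using has_derivative_snd[OF D, THEN has_derivative_fst]
        has_derivative_snd[OF D, THEN has_derivative_snd]
      unfolding differentiable_def V_def L_def by blast+
  qed
  then have "V differentiable_on U" "L differentiable_on U"
    by (auto simp: differentiable_on_def intro: differentiable_at_withinI)
  moreover have "(Afun f A (V \<epsilon>) + \<epsilon> *\<^sub>R (\<Sum>i\<in>UNIV. f i (V \<epsilon>) *\<^sub>R E i)) *v V \<epsilon> = L \<epsilon> *\<^sub>R V \<epsilon>"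
    "(1/2) * (V \<epsilon> \<bullet> V \<epsilon>) = 1" if "\<epsilon> \<in> U" for \<epsilon>
  proof -
    have "G (g (\<epsilon>, 0, 1)) = (\<epsilon>, 0, 1)"
      using that \<open>homeomorphism T' W G g\<close> by (simp add: U_def homeomorphism_apply2)
    then show "(Afun f A (V \<epsilon>) + \<epsilon> *\<^sub>R (\<Sum>i\<in>UNIV. f i (V \<epsilon>) *\<^sub>R E i)) *v V \<epsilon> = L \<epsilon> *\<^sub>R V \<epsilon>"
      "(1/2) * (V \<epsilon> \<bullet> V \<epsilon>) = 1"
      by (auto simp: G_def V_def L_def Afun_def matrix_vector_mult_add_rdistrib
          scaleR_matrix_vector_assoc)
  qed
  ultimately have "perturbed_branch f A E lam v U L V"
    using \<open>open U\<close> \<open>0 \<in> U\<close> g_p by (auto simp: perturbed_branch_def V_def L_def)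
  then show ?thesis by (rule that)
qed

text \<open>Any branch is allowed here, so the value of the derivative is determined without first
  showing that branches are unique.\<close>

lemma eigenvalue_deriv_of_branch:
  fixes f :: "'m::finite \<Rightarrow> real^'n \<Rightarrow> real" and A E :: "'m \<Rightarrow> real^'n^'n"
  assumes C1: "\<And>i. cont_differentiable_on (f i) (UNIV - {0})"
    and v: "v \<noteq> 0"
    and left: "u v* Jac f A v = lam *\<^sub>R u"
    and branch: "perturbed_branch f A E lam v U L V"
    and L': "(L has_real_derivative d) (at 0)"
  shows "d * (u \<bullet> v) = u \<bullet> (Afun f E v *v v)"
proof -
  let ?S = "UNIV - {0 :: real^'n}"
  have U: "open U" "0 \<in> U" and V_diff: "V differentiable_on U" and L0: "L 0 = lam" and V0: "V 0 = v"
    and eq: "\<And>\<epsilon>. \<epsilon> \<in> U \<Longrightarrow> Afun f A (V \<epsilon>) *v V \<epsilon> + \<epsilon> *\<^sub>R (Afun f E (V \<epsilon>) *v V \<epsilon>) = L \<epsilon> *\<^sub>R V \<epsilon>"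
    using branch by (auto simp: perturbed_branch_def Afun_def matrix_vector_mult_add_rdistrib
        scaleR_matrix_vector_assoc)
  obtain DA where DA: "((\<lambda>x. Afun f A x *v x) has_derivative blinfun_apply DA) (at v)"
    using Afun_mult_C1[where f = f and E = A, OF C1] v by blast
  obtain DE where DE: "((\<lambda>x. Afun f E x *v x) has_derivative blinfun_apply DE) (at v)"
    using Afun_mult_C1[where f = f and E = E, OF C1] v by blast
  obtain V' where V': "(V has_derivative V') (at 0)"
    using V_diff U by (auto simp: differentiable_on_def differentiable_def at_within_open[of _ U])
  have A': "((\<lambda>\<epsilon>. Afun f A (V \<epsilon>) *v V \<epsilon>) has_derivative (\<lambda>h. DA (V' h))) (at 0)"
    by (rule has_derivative_compose[OF V']) (simp add: V0 DA)
  have E': "((\<lambda>\<epsilon>. Afun f E (V \<epsilon>) *v V \<epsilon>) has_derivative (\<lambda>h. DE (V' h))) (at 0)"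
    by (rule has_derivative_compose[OF V']) (simp add: V0 DE)
  have lhs: "((\<lambda>\<epsilon>. Afun f A (V \<epsilon>) *v V \<epsilon> + \<epsilon> *\<^sub>R (Afun f E (V \<epsilon>) *v V \<epsilon>))
      has_derivative (\<lambda>h. DA (V' h) + h *\<^sub>R (Afun f E v *v v))) (at 0)"
    by (rule derivative_eq_intros A' E' refl | simp add: V0)+
  have rhs: "((\<lambda>\<epsilon>. L \<epsilon> *\<^sub>R V \<epsilon>) has_derivative (\<lambda>h. lam *\<^sub>R V' h + (d * h) *\<^sub>R v)) (at 0)"
    by (rule derivative_eq_intros V' L'[unfolded has_field_derivative_def] refl
        | simp add: V0 L0)+
  \<comment> \<open>Both sides of the perturbed equation agree on the open set \<open>U\<close>, so
    their derivatives at 0 coincide; direction 1 gives the first-order equation.\<close>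
  have "((\<lambda>\<epsilon>. L \<epsilon> *\<^sub>R V \<epsilon>) has_derivative (\<lambda>h. DA (V' h) + h *\<^sub>R (Afun f E v *v v))) (at 0)"
    by (rule has_derivative_transform_within_open[OF lhs U]) (rule eq)
  from fun_cong[OF has_derivative_unique[OF this rhs], of 1]
  have "DA (V' 1) + Afun f E v *v v = lam *\<^sub>R V' 1 + d *\<^sub>R v"
    by simp
  then have "u \<bullet> (Jac f A v *v V' 1) + u \<bullet> (Afun f E v *v v) = lam * (u \<bullet> V' 1) + d * (u \<bullet> v)"
    by (simp add: Jac_mult[OF DA] flip: inner_add_right inner_scaleR_right)
  moreover have "u \<bullet> (Jac f A v *v V' 1) = lam * (u \<bullet> V' 1)"
    by (simp add: left flip: dot_lmul_matrix)
  ultimately show ?thesis by simp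
qed

text \<open>The description by \<open>THE\<close> is legitimate: a branch exists, and the formula
  forces the same value for every branch.\<close>

lemma eigenvalue_deriv_eq:
  fixes f :: "'m::finite \<Rightarrow> real^'n \<Rightarrow> real" and A E :: "'m \<Rightarrow> real^'n^'n"
  assumes C1: "\<And>i. cont_differentiable_on (f i) (UNIV - {0})"
    and simple: "simple_eigenpair f A lam v"
    and left: "u v* Jac f A v = lam *\<^sub>R u" "u \<noteq> 0"
    and nrm: "(1/2) * (v \<bullet> v) = 1"
  shows "eigenvalue_deriv f A E lam v = u \<bullet> (Afun f E v *v v) / (u \<bullet> v)"
proof -
  have v: "v \<noteq> 0" and uv: "u \<bullet> v \<noteq> 0"
    using simple left_right_eigenvectors_not_orthogonal[OF _ left]
    by (auto simp: simple_eigenpair_def eigenpair_def)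
  have unique: "d = u \<bullet> (Afun f E v *v v) / (u \<bullet> v)"
    if "perturbed_branch f A E lam v U L V" "(L has_real_derivative d) (at 0)" for d U L V
    using eigenvalue_deriv_of_branch[OF C1 v left(1) that] uv by (simp add: field_simps)
  obtain U L V where branch: "perturbed_branch f A E lam v U L V"
    using perturbed_branch_exists[OF C1 simple left nrm] by blast
  then have "L differentiable (at 0)"
    by (auto simp: perturbed_branch_def differentiable_on_def at_within_open[of _ U])
  then obtain d where d: "(L has_real_derivative d) (at 0)"
    by (auto simp: real_differentiable_def)
  show ?thesis
    unfolding eigenvalue_deriv_def
  proof (rule the_equality)
    show "\<exists>U L V. perturbed_branch f A E lam v U L V \<and>
        (L has_real_derivative u \<bullet> (Afun f E v *v v) / (u \<bullet> v)) (at 0)"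
      using branch d unique[OF branch d] by blast
  qed (use unique in blast)
qed

section \<open>Rank-one perturbations and the supremum\<close>

definition outer_product :: "real^'m \<Rightarrow> real^'n \<Rightarrow> real^'n^'m" where
  "outer_product a b = (\<chi> i. a $ i *\<^sub>R b)"

lemma outer_product_mult_vec: "outer_product a b *v x = (b \<bullet> x) *\<^sub>R a"
  by (simp add: vec_eq_iff outer_product_def matrix_vector_mul_component)

lemma norm_outer_product: "norm (outer_product a b) = norm a * norm b"
proof -
  have "norm (outer_product a b) = L2_set (\<lambda>i. \<bar>a $ i\<bar> * norm b) UNIV"
    by (simp add: outer_product_def norm_vec_def[of "\<chi> i. a $ i *\<^sub>R b"])
  then show ?thesis
    by (simp add: norm_vec_def[of a] L2_set_left_distrib)
qed

lemma norm_mult_vec_le_spectral: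
  fixes M :: "real^'n^'n"
  shows "norm (M *v x) \<le> spectral_norm M * norm x"
  unfolding spectral_norm_def by (rule onorm) simp

lemma spectral_norm_le_norm: "spectral_norm M \<le> norm M"
  unfolding spectral_norm_def by (rule onorm_le) (rule norm_matrix_vector_mult_le)

text \<open>The supremum is attained at \<open>E i = sgn (f i v) * w i * u v\<^sup>T / (norm u * norm v)\<close>, for which
  the spectral and the Frobenius norm agree. Hence it suffices that \<open>N\<close> lies between the two.\<close>

lemma eig_cond_eq:
  fixes f :: "'m::finite \<Rightarrow> real^'n \<Rightarrow> real" and A :: "'m \<Rightarrow> real^'n^'n"
    and N :: "real^'n^'n \<Rightarrow> real"
  assumes C1: "\<And>i. cont_differentiable_on (f i) (UNIV - {0})"
    and simple: "simple_eigenpair f A lam v"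
    and nrm: "(1/2) * (v \<bullet> v) = 1"
    and left: "u v* Jac f A v = lam *\<^sub>R u" "u \<noteq> 0"
    and w_nonneg: "\<And>i. w i \<ge> 0"
    and N_ge: "\<And>M. spectral_norm M \<le> N M"
    and N_le: "\<And>M. N M \<le> norm M"
  shows "eig_cond N f A w lam v =
    ereal ((\<Sum>i\<in>UNIV. \<bar>f i v\<bar> * w i) * norm u * norm v / (\<bar>lam\<bar> * \<bar>u \<bullet> v\<bar>))"
proof -
  have v: "v \<noteq> 0" and uv: "u \<bullet> v \<noteq> 0"
    using simple left_right_eigenvectors_not_orthogonal[OF _ left]
    by (auto simp: simple_eigenpair_def eigenpair_def)
  have form: "u \<bullet> (Afun f E v *v v) = (\<Sum>i\<in>UNIV. f i v * (u \<bullet> (E i *v v)))" for E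
  proof -
    interpret bounded_bilinear "(*v) :: real^'n^'n \<Rightarrow> real^'n \<Rightarrow> real^'n"
      by (rule bounded_bilinear_matrix_vector_mult)
    show ?thesis
      by (simp add: Afun_def sum_left scaleR_left inner_sum_right)
  qed
  note deriv = eigenvalue_deriv_eq[OF C1 simple left nrm]
  show ?thesis
    unfolding eig_cond_def
  proof (rule SUP_eqI)
    fix E :: "'m \<Rightarrow> real^'n^'n"
    assume "E \<in> {E. \<forall>i. N (E i) \<le> w i}"
    then have E: "N (E i) \<le> w i" for i by simp
    \<comment> \<open>The upper bound uses \<open>N\<close> only through \<open>N_ge\<close>, as the
      action of \<open>E i\<close> on \<open>v\<close> is controlled by the spectral norm.\<close>
    have "\<bar>u \<bullet> (E i *v v)\<bar> \<le> w i * (norm u * norm v)" for i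
    proof -
      have "\<bar>u \<bullet> (E i *v v)\<bar> \<le> norm u * norm (E i *v v)"
        by (rule Cauchy_Schwarz_ineq2)
      also have "norm (E i *v v) \<le> spectral_norm (E i) * norm v"
        by (rule norm_mult_vec_le_spectral)
      also have "spectral_norm (E i) \<le> w i"
        using N_ge E by (rule order_trans)
      finally show ?thesis
        by (simp add: mult_ac mult_left_mono mult_right_mono)
    qed
    then have "\<bar>u \<bullet> (Afun f E v *v v)\<bar> \<le> (\<Sum>i\<in>UNIV. \<bar>f i v\<bar> * (w i * (norm u * norm v)))"
      unfolding form by (intro order_trans[OF sum_abs] sum_mono) (simp add: abs_mult mult_left_mono)
    also have "\<dots> = (\<Sum>i\<in>UNIV. \<bar>f i v\<bar> * w i) * norm u * norm v"
      by (simp add: sum_distrib_left sum_distrib_right mult_ac)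
    finally show "ereal (\<bar>eigenvalue_deriv f A E lam v\<bar> / \<bar>lam\<bar>)
        \<le> ereal ((\<Sum>i\<in>UNIV. \<bar>f i v\<bar> * w i) * norm u * norm v / (\<bar>lam\<bar> * \<bar>u \<bullet> v\<bar>))"
      by (simp add: deriv abs_divide divide_right_mono mult.commute)
  next
    fix y
    assume y: "\<And>E. E \<in> {E. \<forall>i. N (E i) \<le> w i} \<Longrightarrow>
      ereal (\<bar>eigenvalue_deriv f A E lam v\<bar> / \<bar>lam\<bar>) \<le> y"
    define E :: "'m \<Rightarrow> real^'n^'n" where
      "E i = (sgn (f i v) * w i / (norm u * norm v)) *\<^sub>R outer_product u v" for i
    have "N (E i) \<le> w i" for i
    proof -
      have "N (E i) \<le> norm (E i)" by (rule N_le)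
      \<comment> \<open>Equality holds unless \<open>f i v = 0\<close>; then \<open>sgn\<close> is
        0, \<open>E i\<close> vanishes, and \<open>w_nonneg\<close> closes the case.\<close>
      also have "\<dots> \<le> w i"
        using left(2) v w_nonneg[of i]
        by (simp add: E_def norm_outer_product abs_mult abs_divide abs_sgn_eq)
      finally show ?thesis .
    qed
    moreover have "u \<bullet> (Afun f E v *v v) = (\<Sum>i\<in>UNIV. \<bar>f i v\<bar> * w i) * norm u * norm v"
    proof -
      \<comment> \<open>The factor \<open>sgn (f i v)\<close> aligns the signs, so the triangle
        inequality for the sum is attained along with Cauchy-Schwarz.\<close>
      have "f i v * (u \<bullet> (E i *v v)) = \<bar>f i v\<bar> * w i * (norm u * norm v)" for i
      proof -
        have "u \<bullet> (E i *v v) = sgn (f i v) * w i / (norm u * norm v) * ((norm u)\<^sup>2 * (norm v)\<^sup>2)"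
          by (simp add: E_def outer_product_mult_vec power2_norm_eq_inner
              flip: scaleR_matrix_vector_assoc)
        also have "\<dots> = sgn (f i v) * (w i * (norm u * norm v))"
          using left(2) v by (simp add: power2_eq_square)
        finally show ?thesis
          by (simp add: abs_sgn mult_ac)
      qed
      then show ?thesis
        by (simp add: form sum_distrib_left sum_distrib_right mult_ac)
    qed
    moreover have "(\<Sum>i\<in>UNIV. \<bar>f i v\<bar> * w i) \<ge> 0"
      by (intro sum_nonneg mult_nonneg_nonneg w_nonneg) auto
    ultimately show "ereal ((\<Sum>i\<in>UNIV. \<bar>f i v\<bar> * w i) * norm u * norm v / (\<bar>lam\<bar> * \<bar>u \<bullet> v\<bar>)) \<le> y"
      using y[of E] by (simp add: deriv abs_divide abs_mult mult.commute)
  qed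
qed

theorem theorem3p2:
  fixes f :: "'m::finite \<Rightarrow> real^'n \<Rightarrow> real"
    and A :: "'m \<Rightarrow> real^'n^'n"
    and w :: "'m \<Rightarrow> real"
    and lam :: real
    and u v :: "real^'n"
  assumes sym: "\<And>i. transpose (A i) = A i"
    and scal: "\<And>i. scaling_invariant (f i)"
    and C1: "\<And>i. cont_differentiable_on (f i) (UNIV - {0})"
    and simple: "simple_eigenpair f A lam v"
    and lam_nz: "lam \<noteq> 0"
    and nrm: "(1/2) * (v \<bullet> v) = 1"
    and u_nz: "u \<noteq> 0"
    and left: "u v* Jac f A v = lam *\<^sub>R u"
    and w_nonneg: "\<And>i. w i \<ge> 0"
  shows "eig_cond spectral_norm f A w lam v =
           ereal ((\<Sum>i\<in>UNIV. \<bar>f i v\<bar> * w i) * norm u * norm v / (\<bar>lam\<bar> * \<bar>u \<bullet> v\<bar>))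
       \<and> eig_cond norm f A w lam v =
           ereal ((\<Sum>i\<in>UNIV. \<bar>f i v\<bar> * w i) * norm u * norm v / (\<bar>lam\<bar> * \<bar>u \<bullet> v\<bar>))"
proof
  note eq = eig_cond_eq[OF C1 simple nrm left u_nz w_nonneg]
  show "eig_cond spectral_norm f A w lam v =
      ereal ((\<Sum>i\<in>UNIV. \<bar>f i v\<bar> * w i) * norm u * norm v / (\<bar>lam\<bar> * \<bar>u \<bullet> v\<bar>))"
    by (rule eq) (auto intro: spectral_norm_le_norm)
  show "eig_cond norm f A w lam v =
      ereal ((\<Sum>i\<in>UNIV. \<bar>f i v\<bar> * w i) * norm u * norm v / (\<bar>lam\<bar> * \<bar>u \<bullet> v\<bar>))"
    by (rule eq) (auto intro: spectral_norm_le_norm)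
qed

end
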